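(* Consider the linear coupled power flow (LC-PF) model $p=H_g\varepsilon+H_\beta\theta$, $q=H_\beta\varepsilon-H_g\theta$ on a base-constrained spanning forest $\mathcal F=\bigcup_{k=1}^K\mathcal T_k$, where $p,q$ are random vectors of active and reactive power injections at the non-substation nodes. Assume that for any two non-substation nodes $c,d$ (including $c=d$) lying in the same tree of $\mathcal F$, $\Sigma_p(c,d)=\mathbb E[p_cp_d]>0$, $\Sigma_q(c,d)=\mathbb E[q_cq_d]>0$ and $\Sigma_{pq}(c,d)=\mathbb E[p_cq_d]>0$. If $a\neq b$ are nodes of a tree $\mathcal T_k$ of $\mathcal F$ and $a$ is a descendant of $b$ in $\mathcal T_k$, then $$\Sigma_\varepsilon(a,a)>\Sigma_\varepsilon(b,b),$$ where $\Sigma_\varepsilon(c,d)=\mathbb E[\varepsilon_c\varepsilon_d]$.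
   Context: Forest: $\mathcal F$ is a finite graph that is a disjoint union of $K$ trees $\mathcal T_1,\dots,\mathcal T_K$, with edge set $\mathcal E^{\mathcal F}$; each $\mathcal T_k$ contains exactly one distinguished node (its substation, or slack bus), regarded as the root of $\mathcal T_k$. There are $N$ non-substation nodes. For a node $a$ of $\mathcal T_k$, a node $b$ of $\mathcal T_k$ is a descendant of $a$ if $a$ lies on the unique path in $\mathcal T_k$ from $b$ to the slack bus (so $a$ is a descendant of itself). Line parameters: each edge $(ab)\in\mathcal E^{\mathcal F}$ has resistance $r_{ab}>0$ and reactance $x_{ab}>0$, and $g_{ab}=\frac{r_{ab}}{r_{ab}^2+x_{ab}^2}$, $\beta_{ab}=\frac{x_{ab}}{r_{ab}^2+x_{ab}^2}$ (all symmetric in $a,b$). Reduced weighted Laplacians: for edge weights $w$, $H_w$ is the $N\times N$ matrix indexed by non-substation nodes obtained from the weighted graph Laplacian of $\mathcal F$ (diagonal entry at $a$ equal to $\sum_{c:(ac)\in\mathcal E^{\mathcal F}}w_{ac}$, the sum being over all neighbours including substations; off-diagonal entry $-w_{ab}$ if $(ab)\in\mathcal E^{\mathcal F}$, and $0$ otherwise) by deleting the rows and columns of the $K$ substations. For positive weights it is invertible. $H_g,H_\beta,H_{1/r},H_{1/x}$ use the weights $g_{ab},\beta_{ab},1/r_{ab},1/x_{ab}$ respectively. LC-PF model: $p,q\in\mathbb R^N$ are random vectors (active and reactive power injections at non-substation nodes) with finite second moments; the random vectors $\varepsilon,\theta\in\mathbb R^N$ (voltage magnitude deviations and voltage phases)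 are determined by $p=H_g\varepsilon+H_\beta\theta$, $q=H_\beta\varepsilon-H_g\theta$, equivalently $\varepsilon=H_{1/r}^{-1}p+H_{1/x}^{-1}q$ and $\theta=H_{1/x}^{-1}p-H_{1/r}^{-1}q$. Second moment matrices are non-central: $\Sigma_y=\mathbb E[yy^T]$, $\Sigma_{pq}=\mathbb E[pq^T]$. At every substation node the voltage deviation and phase are fixed to $0$, so entries of $\Sigma_\varepsilon$ involving a substation are $0$. *)

theory Defs
  imports "HOL-Probability.Probability"
begin

(* Finite simple undirected graphs: vertex set, and edges as two-element sets of vertices.
   The AFP notion of tree for digraphs only excludes directed cycles, so it is not
   usable for undirected trees. *)

definition simple_graph :: "'v set \<Rightarrow> 'v set set \<Rightarrow> bool" where
  "simple_graph V E \<longleftrightarrow> finite V \<and> (\<forall>e\<in>E. e \<subseteq> V \<and> card e = 2)"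

definition is_path :: "'v set set \<Rightarrow> 'v \<Rightarrow> 'v \<Rightarrow> 'v list \<Rightarrow> bool" where
  "is_path E u v xs \<longleftrightarrow>
     xs \<noteq> [] \<and> hd xs = u \<and> last xs = v \<and> distinct xs \<and> successively (\<lambda>a b. {a, b} \<in> E) xs"

definition is_cycle :: "'v set set \<Rightarrow> 'v list \<Rightarrow> bool" where
  "is_cycle E xs \<longleftrightarrow>
     length xs \<ge> 3 \<and> distinct xs \<and> successively (\<lambda>a b. {a, b} \<in> E) xs \<and> {last xs, hd xs} \<in> E"

definition is_tree :: "'v set \<Rightarrow> 'v set set \<Rightarrow> bool" where
  "is_tree V E \<longleftrightarrow> simple_graph V E \<and> V \<noteq> {} \<and>
     (\<forall>u\<in>V. \<forall>v\<in>V. \<exists>xs. is_path E u v xs) \<and> (\<nexists>xs. is_cycle E xs)"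

(* Nodes have type 'n + 's: Inl for the N = CARD('n) non-substation nodes, Inr for the
   substations (slack buses).  VT k and ET k are the node and edge sets of the k-th tree;
   since every tree contains exactly one substation, K = CARD('s). *)

definition substation_forest ::
  "nat \<Rightarrow> (nat \<Rightarrow> ('n::finite + 's::finite) set) \<Rightarrow> (nat \<Rightarrow> ('n + 's) set set) \<Rightarrow> bool" where
  "substation_forest K VT ET \<longleftrightarrow>
     (\<forall>k\<in>{1..K}. is_tree (VT k) (ET k) \<and> (\<exists>!s. Inr s \<in> VT k)) \<and>
     disjoint_family_on VT {1..K} \<and> (\<Union>k\<in>{1..K}. VT k) = UNIV"

definition forest_edges :: "nat \<Rightarrow> (nat \<Rightarrow> 'v set set) \<Rightarrow> 'v set set" where
  "forest_edges K ET = (\<Union>k\<in>{1..K}. ET k)"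

(* b is a descendant of a in the tree (V, E).  If this is a tree with exactly one
   substation, then both the substation s and the path xs from b to it are unique. *)

definition descendant :: "('n + 's) set \<Rightarrow> ('n + 's) set set \<Rightarrow> 'n + 's \<Rightarrow> 'n + 's \<Rightarrow> bool" where
  "descendant V E b a \<longleftrightarrow> a \<in> V \<and> b \<in> V \<and>
     (\<exists>s xs. Inr s \<in> V \<and> is_path E b (Inr s) xs \<and> a \<in> set xs)"

(* Line parameters and weights are functions of the (unordered) edge, hence symmetric. *)

definition conductance :: "('v set \<Rightarrow> real) \<Rightarrow> ('v set \<Rightarrow> real) \<Rightarrow> 'v set \<Rightarrow> real" where
  "conductance r x e = r e / ((r e)\<^sup>2 + (x e)\<^sup>2)"

definition susceptance :: "('v set \<Rightarrow> real) \<Rightarrow> ('v set \<Rightarrow> real) \<Rightarrow> 'v set \<Rightarrow> real" where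
  "susceptance r x e = x e / ((r e)\<^sup>2 + (x e)\<^sup>2)"

definition laplacian :: "'v set set \<Rightarrow> ('v set \<Rightarrow> real) \<Rightarrow> real ^ 'v::finite ^ 'v" where
  "laplacian E w = (\<chi> a b.
     if a = b then (\<Sum>c | {a, c} \<in> E. w {a, c})
     else if {a, b} \<in> E then - w {a, b} else 0)"

definition reduced_laplacian ::
  "('n::finite + 's::finite) set set \<Rightarrow> (('n + 's) set \<Rightarrow> real) \<Rightarrow> real ^ 'n ^ 'n" where
  "reduced_laplacian E w = (\<chi> a b. laplacian E w $ Inl a $ Inl b)"

definition lc_pf ::
  "('n::finite + 's::finite) set set \<Rightarrow> (('n + 's) set \<Rightarrow> real) \<Rightarrow> (('n + 's) set \<Rightarrow> real) \<Rightarrow>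
   real ^ 'n \<Rightarrow> real ^ 'n \<Rightarrow> real ^ 'n \<Rightarrow> real ^ 'n \<Rightarrow> bool" where
  "lc_pf E r x p q \<epsilon> \<theta> \<longleftrightarrow>
     (let Hg = reduced_laplacian E (conductance r x);
          H\<beta> = reduced_laplacian E (susceptance r x)
      in p = Hg *v \<epsilon> + H\<beta> *v \<theta> \<and> q = H\<beta> *v \<epsilon> - Hg *v \<theta>)"

(* Extension of a vector of deviations to all nodes, with value 0 at the substations. *)

definition at_all_nodes :: "real ^ 'n \<Rightarrow> real ^ ('n::finite + 's::finite)" where
  "at_all_nodes y = (\<chi> v. case v of Inl c \<Rightarrow> y $ c | Inr s \<Rightarrow> 0)"

(* Non-central: the matrix E[y z^T]. *)

definition second_moment ::
  "'w measure \<Rightarrow> ('w \<Rightarrow> real ^ 'm) \<Rightarrow> ('w \<Rightarrow> real ^ 'm) \<Rightarrow> real ^ 'm ^ 'm::finite" where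
  "second_moment M y z = (\<chi> c d. \<integral>\<omega>. y \<omega> $ c * z \<omega> $ d \<partial>M)"

end

theory Submission
  imports Defs
begin

text \<open>Summing the LC-PF equations over the descendants of a non-substation node \<open>u\<close> cancels
  all internal flows and leaves only the line from \<open>u\<close> to its parent. With \<open>P\<close>, \<open>Q\<close> the sums of
  \<open>p\<close>, \<open>q\<close> over these descendants, and \<open>r\<close>, \<open>x\<close> the parameters of that line, this
  \<open>2 \<times> 2\<close> system inverts to \<open>\<epsilon> u - \<epsilon> (parent u) = r P + x Q\<close>. Adding up along the path to the
  substation writes \<open>\<epsilon> v\<close> as a combination of the injections with nonnegative coefficients, one
  contribution per line of that path. Passing from \<open>b\<close> to a proper descendant \<open>a\<close> lengthens the
  path, so no coefficient decreases and that of \<open>p a\<close> strictly increases; as all second moments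
  within the tree are positive, the quadratic form \<open>E[\<epsilon>\<^sup>2]\<close> strictly increases.\<close>

section \<open>Paths in acyclic graphs\<close>

lemma is_path_Cons_Cons:
  "is_path E u s (x # y # xs) \<longleftrightarrow> x = u \<and> {u, y} \<in> E \<and> x \<notin> set (y # xs) \<and> is_path E y s (y # xs)"
  by (auto simp: is_path_def)

lemma is_path_hd: "is_path E u s xs \<Longrightarrow> \<exists>ys. xs = u # ys"
  by (cases xs) (auto simp: is_path_def)

lemma is_path_refl: "is_path E s s xs \<longleftrightarrow> xs = [s]"
proof
  assume p: "is_path E s s xs"
  then obtain ys where "xs = s # ys" using is_path_hd by metis
  with p show "xs = [s]"
    by (cases ys rule: rev_cases) (auto simp: is_path_def)
qed (simp add: is_path_def)

text \<open>Let \<open>z\<close> be the first node of one path, after the start, that also lies on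
  the other. The two segments from the start to \<open>z\<close> share only their endpoints, so they
  form a cycle unless both are single edges; in that case the induction continues from
  \<open>z\<close>.\<close>

lemma acyclic_unique_path:
  assumes "\<nexists>xs. is_cycle E xs" "is_path E u s xs" "is_path E u s ys"
  shows "xs = ys"
  using assms(2,3)
proof (induction xs arbitrary: u ys)
  case Nil
  then show ?case by (simp add: is_path_def)
next
  case (Cons x xs)
  then have [simp]: "x = u" by (simp add: is_path_def)
  obtain ys' where ys: "ys = u # ys'" using is_path_hd Cons.prems(2) by metis
  show ?case
  proof (cases "xs = [] \<or> ys' = []")
    case True
    then have "u = s" using Cons.prems ys by (auto simp: is_path_def)
    then show ?thesis using Cons.prems is_path_refl by metis
  next
    case False
    then have last: "last xs = s" "last ys' = s"
      using Cons.prems ys by (auto simp: is_path_def)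
    then have "\<exists>z\<in>set xs. z \<in> set ys'" using False last_in_set by metis
    then obtain A z B where xs: "xs = A @ z # B" "z \<in> set ys'" "\<forall>w\<in>set A. w \<notin> set ys'"
      by (auto dest!: split_list_first_prop)
    then obtain C D where ys': "ys' = C @ z # D" by (meson split_list)
    show ?thesis
    proof (cases "A = [] \<and> C = []")
      case True
      then show ?thesis
        using Cons.IH[of z ys'] Cons.prems xs ys ys' by (simp add: is_path_Cons_Cons)
    next
      case False
      \<comment> \<open>The cycle runs from \<open>u\<close> through \<open>A\<close> to
        \<open>z\<close> and returns along \<open>C\<close> backwards. It has at least three nodes
        because \<open>A\<close> or \<open>C\<close> is nonempty.\<close>
      let ?c = "u # A @ z # rev C"
      let ?R = "\<lambda>a b. {a, b} \<in> E"
      have "successively ?R ((u # A @ [z]) @ B)" "successively ?R ((u # C @ [z]) @ D)"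
        using Cons.prems xs ys ys' by (simp_all add: is_path_def)
      then have A: "successively ?R (u # A @ [z])" and C: "successively ?R (u # C @ [z])"
        by (metis successively_append_iff)+
      then have "successively ?R (rev (u # C @ [z]))"
        by (subst successively_rev) (simp add: insert_commute)
      then have "successively ?R ((z # rev C) @ [u])" by simp
      then have "successively ?R (z # rev C)" "{last (z # rev C), u} \<in> E"
        by (subst (asm) successively_append_iff; simp)+
      then have "{last ?c, hd ?c} \<in> E" by simp
      moreover have "successively ?R ((u # A) @ [z])" using A by simp
      then have "successively ?R (u # A)" "{last (u # A), z} \<in> E"
        by (subst (asm) successively_append_iff; simp)+
      then have "successively ?R ((u # A) @ z # rev C)"
        using \<open>successively ?R (z # rev C)\<close> unfolding successively_append_iff by simp
      then have "successively ?R ?c" by simp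
      moreover have "distinct ?c"
        using Cons.prems xs ys ys' by (auto simp: is_path_def)
      moreover have "length ?c \<ge> 3"
        using False by (cases A; cases C) auto
      ultimately have "is_cycle E ?c" by (simp add: is_cycle_def)
      then show ?thesis using assms(1) by blast
    qed
  qed
qed

section \<open>Parents, ancestors and descendants in a rooted tree\<close>

locale rooted_tree =
  fixes V :: "'v set" and E :: "'v set set" and s :: 'v
  assumes tree: "is_tree V E" and root: "s \<in> V"
begin

definition root_path :: "'v \<Rightarrow> 'v list" where
  "root_path v = (THE xs. is_path E v s xs)"

abbreviation ancestors :: "'v \<Rightarrow> 'v set" where
  "ancestors v \<equiv> set (root_path v)"

text \<open>The root path of \<open>s\<close> is \<open>[s]\<close>, so \<open>parent s\<close> is
  the unspecified value \<open>hd []\<close>; this is why facts about parents assume a node other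
  than \<open>s\<close>.\<close>

abbreviation parent :: "'v \<Rightarrow> 'v" where
  "parent v \<equiv> hd (tl (root_path v))"

abbreviation descendants :: "'v \<Rightarrow> 'v set" where
  "descendants u \<equiv> {v \<in> V. u \<in> ancestors v}"

lemma unique_path: "is_path E u s xs \<Longrightarrow> is_path E u s ys \<Longrightarrow> xs = ys"
  using tree acyclic_unique_path by (metis is_tree_def)

lemma root_path_eq: "is_path E v s xs \<Longrightarrow> root_path v = xs"
  unfolding root_path_def using unique_path by blast

lemma is_path_root_path: "v \<in> V \<Longrightarrow> is_path E v s (root_path v)"
  using tree root root_path_eq by (metis is_tree_def)

lemma edge_in: "{u, v} \<in> E \<Longrightarrow> u \<in> V \<and> v \<in> V \<and> u \<noteq> v"
  using tree by (force simp: is_tree_def simple_graph_def)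

lemma root_path_root: "root_path s = [s]"
  using is_path_refl root_path_eq by metis

lemma root_path_step:
  assumes "v \<in> V" "v \<noteq> s"
  shows "root_path v = v # root_path (parent v)" "{v, parent v} \<in> E"
    "v \<notin> ancestors (parent v)" "parent v \<in> V"
proof -
  have p: "is_path E v s (root_path v)" using assms is_path_root_path by blast
  then obtain w ws where w: "root_path v = v # w # ws"
    using is_path_hd assms(2) by (cases "tl (root_path v)") (fastforce simp: is_path_def)+
  with p have e: "{v, w} \<in> E" "v \<notin> set (w # ws)" "is_path E w s (w # ws)"
    by (auto simp: is_path_Cons_Cons)
  then have "root_path w = w # ws" using root_path_eq by blast
  with e w edge_in show "root_path v = v # root_path (parent v)" "{v, parent v} \<in> E"
    "v \<notin> ancestors (parent v)" "parent v \<in> V"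
    by auto
qed

lemma self_ancestor: "v \<in> V \<Longrightarrow> v \<in> ancestors v"
  using root_path_root root_path_step(1) by (metis list.set_intros(1))

text \<open>Passing to the parent shortens the path to the root by one node.\<close>

lemma parent_induct [consumes 1, case_names root step]:
  assumes "v \<in> V" "P s" "\<And>v. v \<in> V \<Longrightarrow> v \<noteq> s \<Longrightarrow> P (parent v) \<Longrightarrow> P v"
  shows "P v"
  using assms(1)
proof (induction "length (root_path v)" arbitrary: v rule: less_induct)
  case less
  show ?case
  proof (cases "v = s")
    case False
    then have "length (root_path (parent v)) < length (root_path v)"
      using root_path_step(1)[OF less.prems] by (metis length_Cons lessI)
    then show ?thesis
      using False assms(3) less root_path_step(4) by blast
  qed (use assms(2) in simp)
qed

text \<open>If \<open>v\<close> is not on the root path of \<open>u\<close>, prepending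
  \<open>v\<close> to that path gives the root path of \<open>v\<close>. If it is, the segment from
  \<open>u\<close> to \<open>v\<close> together with the edge would be a cycle unless
  \<open>v\<close> comes directly after \<open>u\<close>.\<close>

lemma edge_parent:
  assumes "{u, v} \<in> E"
  shows "u \<noteq> s \<and> parent u = v \<or> v \<noteq> s \<and> parent v = u"
proof (cases "v \<in> ancestors u")
  case False
  have p: "is_path E u s (root_path u)" using assms edge_in is_path_root_path by blast
  obtain us where us: "root_path u = u # us" using is_path_hd p by metis
  have "is_path E v s (v # u # us)"
    using p us False assms by (simp add: is_path_Cons_Cons insert_commute)
  then have "root_path v = v # u # us" by (rule root_path_eq)
  moreover from this have "v \<noteq> s" using root_path_root by auto
  ultimately show ?thesis by simp
next
  case True
  have p: "is_path E u s (root_path u)" using assms edge_in is_path_root_path by blast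
  obtain us where us: "root_path u = u # us" using is_path_hd p by metis
  have "v \<in> set us" using True us assms edge_in by auto
  then obtain A B where AB: "us = A @ v # B" by (meson split_list)
  have "A = []"
  proof (rule ccontr)
    assume "A \<noteq> []"
    have "successively (\<lambda>a b. {a, b} \<in> E) ((u # A @ [v]) @ B)"
      using p us AB by (simp add: is_path_def)
    then have "successively (\<lambda>a b. {a, b} \<in> E) (u # A @ [v])"
      by (metis successively_append_iff)
    moreover have "length (u # A @ [v]) \<ge> 3" using \<open>A \<noteq> []\<close> by (cases A) auto
    moreover have "distinct (u # A @ [v])" using p us AB by (auto simp: is_path_def)
    moreover have "{last (u # A @ [v]), hd (u # A @ [v])} \<in> E"
      using assms by (simp add: insert_commute)
    ultimately have "is_cycle E (u # A @ [v])" unfolding is_cycle_def by blast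
    then show False using tree by (auto simp: is_tree_def)
  qed
  moreover from this have "u \<noteq> s" using us AB root_path_root by auto
  ultimately show ?thesis using us AB by simp
qed

lemma ancestors_parent:
  assumes "v \<in> V" "v \<noteq> s"
  shows "ancestors v = insert v (ancestors (parent v))"
  using root_path_step(1)[OF assms] by (metis list.simps(15))

lemma ancestors_subset:
  assumes "v \<in> V" "u \<in> ancestors v"
  shows "ancestors u \<subseteq> ancestors v"
  using assms
proof (induction rule: parent_induct)
  case root
  then show ?case by (simp add: root_path_root)
next
  case (step v)
  then show ?case using ancestors_parent[OF step.hyps] by (cases "u = v") auto
qed

text \<open>If \<open>u\<close> and \<open>v\<close> differed, \<open>u\<close> would be an ancestor
  of \<open>parent v\<close>, and by transitivity so would \<open>v\<close>, although a root path
  visits \<open>v\<close> only once.\<close>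

lemma ancestor_antisym:
  assumes "v \<in> V" "u \<in> ancestors v" "v \<in> ancestors u"
  shows "u = v"
proof (cases "v = s")
  case True
  then show ?thesis using assms(2) by (simp add: root_path_root)
next
  case False
  show ?thesis
  proof (rule ccontr)
    assume "u \<noteq> v"
    then have "u \<in> ancestors (parent v)" using assms ancestors_parent False by blast
    then have "v \<in> ancestors (parent v)"
      using ancestors_subset root_path_step(4) assms False by blast
    then show False using root_path_step(3) assms(1) False by blast
  qed
qed

text \<open>Every edge joins a node to its parent. Children of descendants of \<open>u\<close> are
  again descendants, and so are parents of descendants other than \<open>u\<close> itself.\<close>

lemma edge_leaving_descendants:
  assumes "{v, w} \<in> E" "v \<in> descendants u" "w \<notin> descendants u"
  shows "v = u \<and> w = parent u"
  using edge_parent[OF assms(1)]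
proof
  assume v: "v \<noteq> s \<and> parent v = w"
  then have "ancestors v = insert v (ancestors w)"
    using ancestors_parent assms(2) by blast
  then show ?thesis using assms v edge_in by auto
next
  assume "w \<noteq> s \<and> parent w = v"
  then have "ancestors w = insert w (ancestors v)"
    using ancestors_parent assms(1) edge_in by blast
  then show ?thesis using assms edge_in by auto
qed

lemma root_telescope:
  fixes y :: "'v \<Rightarrow> real"
  assumes "v \<in> V"
  shows "y v = y s + (\<Sum>u\<in>ancestors v - {s}. y u - y (parent u))"
  using assms
proof (induction rule: parent_induct)
  case root
  then show ?case by (simp add: root_path_root)
next
  case (step v)
  have "ancestors v - {s} = insert v (ancestors (parent v) - {s})"
    using ancestors_parent step by auto
  then show ?case using step root_path_step(3) by simp
qed

end

section \<open>Flows across cuts and the reduced Laplacian\<close>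

text \<open>By antisymmetry the flows between two nodes of \<open>D\<close> cancel, which leaves the
  flow out of \<open>D\<close>; this is carried by the single pair \<open>(a, b)\<close>.\<close>

lemma sum_antisymmetric_cut:
  fixes F :: "'v::finite \<Rightarrow> 'v \<Rightarrow> real"
  assumes anti: "\<And>v w. F w v = - F v w"
    and cut: "\<And>v w. v \<in> D \<Longrightarrow> w \<notin> D \<Longrightarrow> F v w \<noteq> 0 \<Longrightarrow> v = a \<and> w = b"
    and ab: "a \<in> D" "b \<notin> D"
  shows "(\<Sum>v\<in>D. \<Sum>w\<in>UNIV. F v w) = F a b"
proof -
  let ?S = "\<Sum>v\<in>D. \<Sum>w\<in>D. F v w"
  have swap: "?S = (\<Sum>v\<in>D. \<Sum>w\<in>D. F w v)"
    by (rule sum.swap)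
  have "(\<Sum>v\<in>D. \<Sum>w\<in>D. F w v) = (\<Sum>v\<in>D. \<Sum>w\<in>D. - F v w)"
    by (rule sum.cong[OF refl], rule sum.cong[OF refl], rule anti)
  then have "?S = - ?S" unfolding sum_negf by (rule trans[OF swap])
  then have inner: "?S = 0" unfolding equal_neg_zero .
  have "F v w = (if v = a \<and> w = b then F a b else 0)" if "v \<in> D" "w \<in> - D" for v w
    using cut[of v w] that by (cases "F v w = 0") auto
  then have "(\<Sum>v\<in>D. \<Sum>w\<in>-D. F v w) = (\<Sum>v\<in>D. \<Sum>w\<in>-D. if v = a \<and> w = b then F a b else 0)"
    by (intro sum.cong refl)
  also have "\<dots> = (\<Sum>v\<in>D. if v = a then (\<Sum>w\<in>-D. if w = b then F a b else 0) else 0)"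
    by (intro sum.cong) auto
  also have "\<dots> = F a b" using ab by simp
  finally have outer: "(\<Sum>v\<in>D. \<Sum>w\<in>-D. F v w) = F a b" .
  have "(\<Sum>w\<in>UNIV. F v w) = (\<Sum>w\<in>D. F v w) + (\<Sum>w\<in>-D. F v w)" for v
    using sum.subset_diff[of D UNIV "F v"] by (simp add: Compl_eq_Diff_UNIV)
  then show ?thesis using inner outer by (simp add: sum.distrib)
qed

text \<open>The flow from \<open>u\<close> to \<open>v\<close> driven by the potential
  \<open>y\<close>. The value 0 off the edges lets sums over neighbours range over all
  nodes.\<close>

definition edge_flow ::
  "'v set set \<Rightarrow> ('v set \<Rightarrow> real) \<Rightarrow> ('v \<Rightarrow> real) \<Rightarrow> 'v \<Rightarrow> 'v \<Rightarrow> real" where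
  "edge_flow E w y u v = (if {u, v} \<in> E then w {u, v} * (y u - y v) else 0)"

text \<open>The potential vanishes at the substations, so their deleted columns can be restored. A
  row of the full Laplacian then gives the net outflow at its node; without loops the diagonal entry
  and the neighbour entries stay separate.\<close>

lemma reduced_laplacian_mult:
  fixes E :: "('n::finite + 's::finite) set set" and y :: "real ^ 'n"
  assumes no_loop: "\<And>v. {v} \<notin> E"
  defines "Y \<equiv> ($) (at_all_nodes y :: real ^ ('n + 's))"
  shows "(reduced_laplacian E w *v y) $ c = (\<Sum>v\<in>UNIV. edge_flow E w Y (Inl c) v)"
proof -
  let ?N = "{v. {Inl c, v} \<in> E}" and ?L = "laplacian E w $ Inl c"
  have "(reduced_laplacian E w *v y) $ c = (\<Sum>d\<in>UNIV. ?L $ Inl d * Y (Inl d))"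
    by (simp add: matrix_vector_mult_def reduced_laplacian_def Y_def at_all_nodes_def)
  also have "\<dots> = (\<Sum>v\<in>UNIV. ?L $ v * Y v)"
    unfolding UNIV_Plus_UNIV[symmetric]
    by (subst sum.Plus) (simp_all add: Y_def at_all_nodes_def)
  also have "\<dots> = (\<Sum>v\<in>UNIV. (if v = Inl c then (\<Sum>u\<in>?N. w {Inl c, u}) * Y v else 0)
      - (if v \<in> ?N then w {Inl c, v} * Y v else 0))"
    using no_loop by (intro sum.cong) (auto simp: laplacian_def)
  also have "\<dots> = (\<Sum>u\<in>?N. w {Inl c, u}) * Y (Inl c) - (\<Sum>v\<in>?N. w {Inl c, v} * Y v)"
    by (simp add: sum_subtractf sum.If_cases)
  also have "\<dots> = (\<Sum>v\<in>?N. edge_flow E w Y (Inl c) v)"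
    by (simp add: sum_distrib_right sum_subtractf[symmetric] edge_flow_def right_diff_distrib)
  also have "\<dots> = (\<Sum>v\<in>UNIV. edge_flow E w Y (Inl c) v)"
    by (intro sum.mono_neutral_left) (auto simp: edge_flow_def)
  finally show ?thesis .
qed

text \<open>With \<open>g\<close> and \<open>\<beta>\<close> the conductance and susceptance of the
  line, this rests on \<open>r g + x \<beta> = 1\<close> and \<open>r \<beta> = x g\<close>: the
  first recovers \<open>d\<close>, the second eliminates \<open>t\<close>.\<close>

lemma impedance_inverse:
  fixes d t :: real
  assumes "r e > 0" "x e > 0"
    and "P = conductance r x e * d + susceptance r x e * t"
    and "Q = susceptance r x e * d - conductance r x e * t"
  shows "d = r e * P + x e * Q"
proof -
  have n: "(r e)\<^sup>2 + (x e)\<^sup>2 \<noteq> 0" using assms(1) by (simp add: sum_power2_eq_zero_iff)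
  have "r e * P + x e * Q = ((r e)\<^sup>2 + (x e)\<^sup>2) * d / ((r e)\<^sup>2 + (x e)\<^sup>2)"
    unfolding assms(3,4) conductance_def susceptance_def
    by (simp add: add_divide_distrib algebra_simps power2_eq_square)
  then show ?thesis unfolding nonzero_mult_div_cancel_left[OF n] by simp
qed

section \<open>The LC-PF equations on one tree of the forest\<close>

text \<open>The node sets of the trees are disjoint, so an edge that touches \<open>VT k\<close>
  cannot come from another tree.\<close>

lemma forest_edges_incident:
  assumes "substation_forest K VT ET" "k \<in> {1..K}" "u \<in> VT k"
  shows "{u, v} \<in> forest_edges K ET \<longleftrightarrow> {u, v} \<in> ET k"
proof
  assume "{u, v} \<in> forest_edges K ET"
  then obtain j where j: "j \<in> {1..K}" "{u, v} \<in> ET j" by (auto simp: forest_edges_def)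
  then have "simple_graph (VT j) (ET j)"
    using assms(1) by (simp add: substation_forest_def is_tree_def)
  then have "{u, v} \<subseteq> VT j" using j(2) unfolding simple_graph_def by blast
  then have "VT j \<inter> VT k \<noteq> {}" using assms(3) by blast
  then have "j = k"
    using assms(1,2) j(1) unfolding substation_forest_def disjoint_family_on_def by blast
  then show "{u, v} \<in> ET k" using j by simp
qed (use assms(2) in \<open>auto simp: forest_edges_def\<close>)

lemma forest_edges_no_loop:
  assumes "substation_forest K VT ET"
  shows "{v} \<notin> forest_edges K ET"
  using assms
  by (fastforce simp: forest_edges_def substation_forest_def is_tree_def simple_graph_def)

text \<open>One tree of the forest is singled out, and its only substation is named so that it can
  serve as the root.\<close>

locale lc_pf_tree =
  fixes K :: nat
    and VT :: "nat \<Rightarrow> ('n::finite + 's::finite) set"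
    and ET :: "nat \<Rightarrow> ('n + 's) set set"
    and r x :: "('n + 's) set \<Rightarrow> real"
    and k :: nat and slack :: 's
  assumes forest: "substation_forest K VT ET"
    and r_pos: "\<And>e. e \<in> forest_edges K ET \<Longrightarrow> r e > 0"
    and x_pos: "\<And>e. e \<in> forest_edges K ET \<Longrightarrow> x e > 0"
    and k: "k \<in> {1..K}"
    and slack: "Inr slack \<in> VT k"
begin

sublocale rooted_tree "VT k" "ET k" "Inr slack"
  using forest k slack by unfold_locales (auto simp: substation_forest_def)

lemma slack_unique: "Inr t \<in> VT k \<Longrightarrow> t = slack"
  using forest k slack unfolding substation_forest_def by blast

text \<open>The only substation of the tree is the root, whose sole ancestor is itself. Hence sums
  over the rows of a reduced Laplacian can cover all descendants of \<open>u\<close>.\<close>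

lemma descendants_non_substation:
  assumes "u \<noteq> Inr slack"
  shows "descendants u = Inl ` {d. Inl d \<in> descendants u}"
proof -
  have "v \<in> range Inl" if "v \<in> descendants u" for v
  proof (cases v)
    case (Inr t)
    then have "v = Inr slack" using that slack_unique by auto
    then show ?thesis using that assms by (simp add: root_path_root)
  qed simp
  then show ?thesis by blast
qed

lemma parent_edge:
  assumes "u \<in> VT k" "u \<noteq> Inr slack"
  shows "{u, parent u} \<in> forest_edges K ET"
  using root_path_step(2)[OF assms] forest_edges_incident[OF forest k assms(1)] by simp

text \<open>The sum is the net outflow from the descendants of \<open>u\<close>, and the only edge
  leaving them goes from \<open>u\<close> to its parent.\<close>

lemma sum_descendants_laplacian:
  fixes y :: "real ^ 'n"
  assumes u: "u \<in> VT k" "u \<noteq> Inr slack"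
  defines "Y \<equiv> ($) (at_all_nodes y :: real ^ ('n + 's))"
  shows "(\<Sum>d | Inl d \<in> descendants u. (reduced_laplacian (forest_edges K ET) w *v y) $ d) =
    w {u, parent u} * (Y u - Y (parent u))"
proof -
  let ?F = "edge_flow (forest_edges K ET) w Y"
  have "(\<Sum>d | Inl d \<in> descendants u. (reduced_laplacian (forest_edges K ET) w *v y) $ d) =
      (\<Sum>d | Inl d \<in> descendants u. \<Sum>v\<in>UNIV. ?F (Inl d) v)"
    unfolding Y_def by (simp only: reduced_laplacian_mult[OF forest_edges_no_loop[OF forest]])
  also have "\<dots> = (\<Sum>c\<in>descendants u. \<Sum>v\<in>UNIV. ?F c v)"
    by (subst descendants_non_substation[OF u(2)], subst sum.reindex) (simp_all add: inj_on_def)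
  also have "\<dots> = ?F u (parent u)"
  proof (rule sum_antisymmetric_cut)
    show "?F w v = - ?F v w" for v w
      by (simp add: edge_flow_def insert_commute algebra_simps)
    show "v = u \<and> w = parent u"
      if "v \<in> descendants u" "w \<notin> descendants u" "?F v w \<noteq> 0" for v w
    proof (rule edge_leaving_descendants)
      show "{v, w} \<in> ET k"
        using that forest_edges_incident[OF forest k, of v w]
        by (auto simp: edge_flow_def split: if_splits)
    qed (use that in blast)+
    show "u \<in> descendants u" using u self_ancestor by blast
    show "parent u \<notin> descendants u" using root_path_step(3)[OF u] by blast
  qed
  finally show ?thesis using parent_edge[OF u] by (simp add: edge_flow_def)
qed

text \<open>Both LC-PF equations, summed over the descendants of \<open>u\<close>, become scalar
  equations in the drops of \<open>\<epsilon>\<close> and \<open>\<theta>\<close> along one line,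
  which \<open>impedance_inverse\<close> solves for the drop of \<open>\<epsilon>\<close>.\<close>

lemma lc_pf_edge_drop:
  assumes "lc_pf (forest_edges K ET) r x p q \<epsilon> \<theta>" and u: "u \<in> VT k" "u \<noteq> Inr slack"
  defines "Y \<equiv> ($) (at_all_nodes \<epsilon> :: real ^ ('n + 's))"
  shows "Y u - Y (parent u) =
    r {u, parent u} * (\<Sum>d | Inl d \<in> descendants u. p $ d) +
    x {u, parent u} * (\<Sum>d | Inl d \<in> descendants u. q $ d)"
proof (rule impedance_inverse)
  show "r {u, parent u} > 0" "x {u, parent u} > 0"
    using r_pos x_pos parent_edge[OF u] by blast+
  show "(\<Sum>d | Inl d \<in> descendants u. p $ d) =
      conductance r x {u, parent u} * (Y u - Y (parent u)) + susceptance r x {u, parent u} *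
        ((at_all_nodes \<theta> :: real ^ ('n + 's)) $ u - (at_all_nodes \<theta> :: real ^ ('n + 's)) $ parent u)"
    using assms(1) unfolding lc_pf_def Let_def Y_def
    by (simp only: vector_add_component sum.distrib sum_descendants_laplacian[OF u])
  show "(\<Sum>d | Inl d \<in> descendants u. q $ d) =
      susceptance r x {u, parent u} * (Y u - Y (parent u)) - conductance r x {u, parent u} *
        ((at_all_nodes \<theta> :: real ^ ('n + 's)) $ u - (at_all_nodes \<theta> :: real ^ ('n + 's)) $ parent u)"
    using assms(1) unfolding lc_pf_def Let_def Y_def
    by (simp only: vector_minus_component sum_subtractf sum_descendants_laplacian[OF u])
qed

text \<open>The injections \<open>p\<close> and \<open>q\<close> are merged into one vector indexed by \<open>'n + 'n\<close>, so that
  \<open>injection_coeff v (Inl d)\<close> and \<open>injection_coeff v (Inr d)\<close> are the entries at \<open>(v, d)\<close> of the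
  inverses of the reduced Laplacians with weights \<open>1/r\<close> and \<open>1/x\<close>.\<close>

definition edge_coeff :: "'n + 's \<Rightarrow> 'n + 'n \<Rightarrow> real" where
  "edge_coeff u i = (if case_sum Inl Inl i \<in> descendants u
     then (case i of Inl _ \<Rightarrow> r {u, parent u} | Inr _ \<Rightarrow> x {u, parent u}) else 0)"

definition injection_coeff :: "'n + 's \<Rightarrow> 'n + 'n \<Rightarrow> real" where
  "injection_coeff v i = (\<Sum>u\<in>ancestors v - {Inr slack}. edge_coeff u i)"

lemma ancestors_subset_tree: "v \<in> VT k \<Longrightarrow> ancestors v \<subseteq> VT k"
proof (induction rule: parent_induct)
  case root
  then show ?case using slack by (simp add: root_path_root)
next
  case (step v)
  then show ?case using ancestors_parent by auto
qed

lemma voltage_eq_injection_coeff: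
  assumes pf: "lc_pf (forest_edges K ET) r x p q \<epsilon> \<theta>" and v: "v \<in> VT k"
  shows "(at_all_nodes \<epsilon> :: real ^ ('n + 's)) $ v =
    (\<Sum>i\<in>UNIV. injection_coeff v i * (case i of Inl d \<Rightarrow> p $ d | Inr d \<Rightarrow> q $ d))"
proof -
  let ?Y = "at_all_nodes \<epsilon> :: real ^ ('n + 's)" and ?A = "ancestors v - {Inr slack}"
  let ?D = "\<lambda>u. {d. Inl d \<in> descendants u}"
  \<comment> \<open>The telescoping sum starts from the value at the substation, which is 0.\<close>
  have "?Y $ v = (\<Sum>u\<in>?A. ?Y $ u - ?Y $ parent u)"
    using root_telescope[OF v, of "($) ?Y"] by (simp add: at_all_nodes_def)
  also have "\<dots> = (\<Sum>u\<in>?A. r {u, parent u} * (\<Sum>d\<in>?D u. p $ d) +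
      x {u, parent u} * (\<Sum>d\<in>?D u. q $ d))"
    using ancestors_subset_tree[OF v] by (intro sum.cong refl lc_pf_edge_drop[OF pf]) auto
  also have "\<dots> = (\<Sum>d\<in>UNIV. injection_coeff v (Inl d) * p $ d) +
      (\<Sum>d\<in>UNIV. injection_coeff v (Inr d) * q $ d)"
  proof -
    \<comment> \<open>After exchanging the sums, the coefficient of \<open>z $ d\<close> collects
      the lines common to the root paths of \<open>v\<close> and \<open>d\<close>.\<close>
    have "(\<Sum>u\<in>?A. f u * (\<Sum>d\<in>?D u. z $ d)) =
        (\<Sum>d\<in>UNIV. (\<Sum>u\<in>?A. if Inl d \<in> descendants u then f u else 0) * z $ d)"
      for f :: "'n + 's \<Rightarrow> real" and z :: "real ^ 'n"
    proof -
      have "(\<Sum>u\<in>?A. f u * (\<Sum>d\<in>?D u. z $ d)) =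
          (\<Sum>u\<in>?A. \<Sum>d\<in>UNIV. (if Inl d \<in> descendants u then f u else 0) * z $ d)"
        unfolding sum_distrib_left by (intro sum.cong refl sum.mono_neutral_cong_left) auto
      also have "\<dots> = (\<Sum>d\<in>UNIV. \<Sum>u\<in>?A. (if Inl d \<in> descendants u then f u else 0) * z $ d)"
        by (rule sum.swap)
      finally show ?thesis unfolding sum_distrib_right .
    qed
    then show ?thesis unfolding injection_coeff_def edge_coeff_def sum.distrib by (simp cong: if_cong)
  qed
  also have "\<dots> = (\<Sum>i\<in>UNIV. injection_coeff v i * (case i of Inl d \<Rightarrow> p $ d | Inr d \<Rightarrow> q $ d))"
    unfolding UNIV_Plus_UNIV[symmetric] by (subst sum.Plus) simp_all
  finally show ?thesis .
qed

lemma edge_coeff_nonneg: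
  assumes "u \<in> VT k" "u \<noteq> Inr slack"
  shows "edge_coeff u i \<ge> 0"
  using r_pos[OF parent_edge[OF assms]] x_pos[OF parent_edge[OF assms]]
  by (auto simp: edge_coeff_def split: sum.split)

lemma injection_coeff_nonneg:
  assumes "v \<in> VT k"
  shows "injection_coeff v i \<ge> 0"
  unfolding injection_coeff_def
  using ancestors_subset_tree[OF assms] by (intro sum_nonneg edge_coeff_nonneg) auto

text \<open>Injections of other trees do not influence the voltages of this one, so only second
  moments within the tree enter the comparison.\<close>

lemma injection_coeff_outside:
  assumes "case_sum Inl Inl i \<notin> VT k"
  shows "injection_coeff v i = 0"
  using assms by (simp add: injection_coeff_def edge_coeff_def)

lemma injection_coeff_mono:
  assumes "a \<in> VT k" "b \<in> ancestors a"
  shows "injection_coeff b i \<le> injection_coeff a i"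
  unfolding injection_coeff_def
proof (rule sum_mono2)
  show "ancestors b - {Inr slack} \<subseteq> ancestors a - {Inr slack}"
    using ancestors_subset assms by blast
qed (use ancestors_subset_tree[OF assms(1)] in \<open>auto intro: edge_coeff_nonneg\<close>)

text \<open>The line from \<open>Inl d\<close> to its parent lies on the root path of
  \<open>Inl d\<close> but not on that of \<open>b\<close>, and it contributes its resistance, which
  is positive.\<close>

lemma injection_coeff_strict:
  assumes a: "Inl d \<in> VT k" and b: "b \<in> ancestors (Inl d)" "b \<noteq> Inl d"
  shows "injection_coeff b (Inl d) < injection_coeff (Inl d) (Inl d)"
  unfolding injection_coeff_def
proof (rule sum_strict_mono2)
  show "ancestors b - {Inr slack} \<subseteq> ancestors (Inl d) - {Inr slack}"
    using ancestors_subset a b by blast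
  show "Inl d \<in> (ancestors (Inl d) - {Inr slack}) - (ancestors b - {Inr slack})"
    using ancestor_antisym[OF a b(1)] b(2) self_ancestor[OF a] by auto
  show "0 < edge_coeff (Inl d) (Inl d)"
    using r_pos[OF parent_edge[OF a]] self_ancestor[OF a] a by (simp add: edge_coeff_def)
qed (use ancestors_subset_tree[OF a] in \<open>auto intro!: edge_coeff_nonneg\<close>)

end

section \<open>Second moments as quadratic forms\<close>

text \<open>The products \<open>Z i * Z j\<close> are integrable because
  \<open>\<bar>s * t\<bar> \<le> s\<^sup>2 + t\<^sup>2\<close>, so the expanded square can be
  integrated term by term.\<close>

lemma integral_square_linear_combination:
  fixes Z :: "'i::finite \<Rightarrow> 'w \<Rightarrow> real"
  assumes "\<And>i. Z i \<in> borel_measurable M" "\<And>i. integrable M (\<lambda>\<omega>. (Z i \<omega>)\<^sup>2)"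
    and "Y \<in> borel_measurable M" "AE \<omega> in M. Y \<omega> = (\<Sum>i\<in>UNIV. c i * Z i \<omega>)"
  shows "(\<integral>\<omega>. Y \<omega> * Y \<omega> \<partial>M) = (\<Sum>(i, j)\<in>UNIV. c i * c j * (\<integral>\<omega>. Z i \<omega> * Z j \<omega> \<partial>M))"
proof -
  have int: "integrable M (\<lambda>\<omega>. Z i \<omega> * Z j \<omega>)" for i j
  proof (rule Bochner_Integration.integrable_bound)
    show "integrable M (\<lambda>\<omega>. (Z i \<omega>)\<^sup>2 + (Z j \<omega>)\<^sup>2)" using assms(2) by simp
    have "\<bar>s * t\<bar> \<le> s\<^sup>2 + t\<^sup>2" for s t :: real
      using sum_squares_bound[of "\<bar>s\<bar>" "\<bar>t\<bar>"] abs_ge_zero[of "s * t"]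
      unfolding power2_abs abs_mult by linarith
    then show "AE \<omega> in M. norm (Z i \<omega> * Z j \<omega>) \<le> norm ((Z i \<omega>)\<^sup>2 + (Z j \<omega>)\<^sup>2)"
      by simp
  qed (use assms(1) in measurable)
  have "(\<integral>\<omega>. Y \<omega> * Y \<omega> \<partial>M) =
      (\<integral>\<omega>. (\<Sum>i\<in>UNIV. \<Sum>j\<in>UNIV. c i * c j * (Z i \<omega> * Z j \<omega>)) \<partial>M)"
  proof (rule integral_cong_AE)
    show "AE \<omega> in M. Y \<omega> * Y \<omega> = (\<Sum>i\<in>UNIV. \<Sum>j\<in>UNIV. c i * c j * (Z i \<omega> * Z j \<omega>))"
      using assms(4) by eventually_elim (simp add: sum_product mult_ac)
  qed (use assms(1,3) in measurable)
  also have "\<dots> = (\<Sum>i\<in>UNIV. \<Sum>j\<in>UNIV. c i * c j * (\<integral>\<omega>. Z i \<omega> * Z j \<omega> \<partial>M))"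
    using int by simp
  finally show ?thesis by (simp add: sum.cartesian_product)
qed

lemma borel_measurable_component:
  "f \<in> borel_measurable M \<Longrightarrow> (\<lambda>\<omega>. (f \<omega> :: real ^ 'm::finite) $ c) \<in> borel_measurable M"
  by (rule borel_measurable_continuous_on[where f = "\<lambda>v. v $ c"]) (intro continuous_intros)

theorem theorem2:
  fixes K :: nat
    and VT :: "nat \<Rightarrow> ('n::finite + 's::finite) set"
    and ET :: "nat \<Rightarrow> ('n + 's) set set"
    and r x :: "('n + 's) set \<Rightarrow> real"
    and M :: "'w measure"
    and p q \<epsilon> \<theta> :: "'w \<Rightarrow> real ^ 'n"
    and k :: nat
    and a b :: "'n + 's"
  assumes forest: "substation_forest K VT ET"
    and r_pos: "\<And>e. e \<in> forest_edges K ET \<Longrightarrow> r e > 0"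
    and x_pos: "\<And>e. e \<in> forest_edges K ET \<Longrightarrow> x e > 0"
    and prob: "prob_space M"
    and p_rv: "p \<in> borel_measurable M"
    and q_rv: "q \<in> borel_measurable M"
    and \<epsilon>_rv: "\<epsilon> \<in> borel_measurable M"
    and \<theta>_rv: "\<theta> \<in> borel_measurable M"
    and p_moments: "\<And>c. integrable M (\<lambda>\<omega>. (p \<omega> $ c)\<^sup>2)"
    and q_moments: "\<And>c. integrable M (\<lambda>\<omega>. (q \<omega> $ c)\<^sup>2)"
    and lc_pf: "AE \<omega> in M. lc_pf (forest_edges K ET) r x (p \<omega>) (q \<omega>) (\<epsilon> \<omega>) (\<theta> \<omega>)"
    and \<Sigma>_pos: "\<And>j c d. j \<in> {1..K} \<Longrightarrow> Inl c \<in> VT j \<Longrightarrow> Inl d \<in> VT j \<Longrightarrow>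
      second_moment M p p $ c $ d > 0 \<and>
      second_moment M q q $ c $ d > 0 \<and>
      second_moment M p q $ c $ d > 0"
    and k: "k \<in> {1..K}"
    and ab: "a \<in> VT k" "b \<in> VT k" "a \<noteq> b"
    and desc: "descendant (VT k) (ET k) a b"
  shows "let \<Sigma>\<epsilon> = second_moment M (\<lambda>\<omega>. at_all_nodes (\<epsilon> \<omega>)) (\<lambda>\<omega>. at_all_nodes (\<epsilon> \<omega>))
         in \<Sigma>\<epsilon> $ a $ a > \<Sigma>\<epsilon> $ b $ b"
proof -
  from desc obtain t xs where t: "Inr t \<in> VT k" "is_path (ET k) a (Inr t) xs" "b \<in> set xs"
    by (auto simp: descendant_def)
  interpret lc_pf_tree K VT ET r x k t
    using forest r_pos x_pos k t(1) by unfold_locales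
  have b: "b \<in> ancestors a" using t root_path_eq by simp
  \<comment> \<open>The root has no ancestor but itself, while \<open>b\<close> is an ancestor of
    \<open>a\<close> different from \<open>a\<close>.\<close>
  then have "a \<noteq> Inr t" using ab(3) root_path_root by auto
  then obtain d where d: "a = Inl d" using slack_unique ab(1) by (cases a) auto
  let ?Z = "\<lambda>i \<omega>. case i of Inl c \<Rightarrow> p \<omega> $ c | Inr c \<Rightarrow> q \<omega> $ c"
  let ?m = "\<lambda>i j. \<integral>\<omega>. ?Z i \<omega> * ?Z j \<omega> \<partial>M"
  let ?S = "second_moment M (\<lambda>\<omega>. at_all_nodes (\<epsilon> \<omega>)) (\<lambda>\<omega>. at_all_nodes (\<epsilon> \<omega>)) :: real ^ ('n + 's) ^ ('n + 's)"
  let ?node = "case_sum Inl Inl :: 'n + 'n \<Rightarrow> 'n + 's"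
  have form: "?S $ v $ v =
      (\<Sum>(i, j)\<in>UNIV. injection_coeff v i * injection_coeff v j * ?m i j)" if "v \<in> VT k" for v
    unfolding second_moment_def vec_lambda_beta
  proof (rule integral_square_linear_combination)
    show "?Z i \<in> borel_measurable M" for i
      using p_rv q_rv by (cases i) (simp_all add: borel_measurable_component)
    show "integrable M (\<lambda>\<omega>. (?Z i \<omega>)\<^sup>2)" for i
      using p_moments q_moments by (cases i) simp_all
    show "(\<lambda>\<omega>. (at_all_nodes (\<epsilon> \<omega>) :: real ^ ('n + 's)) $ v) \<in> borel_measurable M"
      using \<epsilon>_rv by (cases v) (simp_all add: at_all_nodes_def borel_measurable_component)
    show "AE \<omega> in M. (at_all_nodes (\<epsilon> \<omega>) :: real ^ ('n + 's)) $ v =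
        (\<Sum>i\<in>UNIV. injection_coeff v i * ?Z i \<omega>)"
      using lc_pf by eventually_elim (rule voltage_eq_injection_coeff[OF _ that])
  qed
  \<comment> \<open>The assumption covers the mixed moments only in the order \<open>p\<close>,
    \<open>q\<close>; the other order follows by commuting the factors.\<close>
  have pos: "?m i j > 0" if "?node i \<in> VT k" "?node j \<in> VT k" for i j
    using that \<Sigma>_pos[OF k]
    by (cases i; cases j) (auto simp: second_moment_def mult.commute[of "q _ $ _" "p _ $ _"])
  have "(\<Sum>(i, j)\<in>UNIV. injection_coeff b i * injection_coeff b j * ?m i j) <
      (\<Sum>(i, j)\<in>UNIV. injection_coeff a i * injection_coeff a j * ?m i j)"
  proof (rule sum_strict_mono_ex1)
    show "\<forall>ij\<in>UNIV. (case ij of (i, j) \<Rightarrow> injection_coeff b i * injection_coeff b j * ?m i j) \<le>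
        (case ij of (i, j) \<Rightarrow> injection_coeff a i * injection_coeff a j * ?m i j)"
    proof clarify
      fix i j
      show "injection_coeff b i * injection_coeff b j * ?m i j \<le>
          injection_coeff a i * injection_coeff a j * ?m i j"
      \<comment> \<open>If one of the nodes lies outside the tree, the sign of \<open>?m i j\<close>
        may be unknown, but both coefficient products are 0.\<close>
      proof (cases "?node i \<in> VT k \<and> ?node j \<in> VT k")
        case True
        then show ?thesis
          using pos[of i j] injection_coeff_mono[OF ab(1) b] injection_coeff_nonneg ab(1,2)
          by (intro mult_right_mono mult_mono) (auto intro: less_imp_le)
      next
        case False
        then have "injection_coeff v i * injection_coeff v j = 0" for v
          using injection_coeff_outside by auto
        then show ?thesis by (simp only: mult_zero_left order_refl)
      qed
    qed
    have "injection_coeff b (Inl d) < injection_coeff a (Inl d)"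
      using injection_coeff_strict ab b d by metis
    then have "injection_coeff b (Inl d) * injection_coeff b (Inl d) <
        injection_coeff a (Inl d) * injection_coeff a (Inl d)"
      using injection_coeff_nonneg[OF ab(2)] by (intro mult_strict_mono') auto
    moreover have "?m (Inl d) (Inl d) > 0" using pos[of "Inl d" "Inl d"] ab(1) d by simp
    ultimately have "injection_coeff b (Inl d) * injection_coeff b (Inl d) * ?m (Inl d) (Inl d) <
        injection_coeff a (Inl d) * injection_coeff a (Inl d) * ?m (Inl d) (Inl d)"
      by (rule mult_strict_right_mono)
    then show "\<exists>ij\<in>UNIV. (case ij of (i, j) \<Rightarrow> injection_coeff b i * injection_coeff b j * ?m i j) <
        (case ij of (i, j) \<Rightarrow> injection_coeff a i * injection_coeff a j * ?m i j)"
      \<comment> \<open>The strict increase occurs at the diagonal term of the active injection at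
        \<open>a\<close> itself.\<close>
      by (intro bexI[of _ "(Inl d, Inl d)"]) simp_all
  qed simp
  then show ?thesis using form ab by (simp add: Let_def)
qed

end
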